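(* Let $V$ be a set with $|V|=n$ and let $H_1=(V,E_1),\dots,H_n=(V,E_n)$ be any undirected hypergraphs on vertex set $V$. Then there exists a directed hypergraph $G$ on $2n$ vertices such that, given a $(1\pm\varepsilon)$ cut-sketch for $G$, for any $i\in\{1,\dots,n\}$ and any $S\subseteq V$ one can recover $\mathrm{cut}_{H_i}(S)$ to within additive error $3\varepsilon|E_i|$.
   Context: For an (unweighted) undirected hypergraph $H=(V,E)$ with hyperedges $e\subseteq V$ and $S\subseteq V$, $\mathrm{cut}_H(S)=|\{e\in E: e\cap S\ne\emptyset,\ e\not\subseteq S\}|$. A directed hypergraph has directed hyperedges $e=(L(e),R(e))$ with $L(e),R(e)$ subsets of its vertex set $U$; for $S\subseteq U$, $\mathrm{cut}_G(S)$ is the number of hyperedges $e$ with $L(e)\cap S\ne\emptyset$ and $R(e)\cap(U\setminus S)\ne\emptyset$. A $(1\pm\varepsilon)$ cut-sketch of $G$ is a data structure from which, for any $S\subseteq U$, one can deterministically recover $\mathrm{cut}_G(S)$ to within a $(1\pm\varepsilon)$ factor using only the data structure and $S$. *)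

theory Defs
  imports Complex_Main
begin

definition hypergraph :: "'a set \<Rightarrow> 'a set set \<Rightarrow> bool" where
  "hypergraph V E \<longleftrightarrow> finite V \<and> E \<subseteq> Pow V"

definition hcut :: "'a set set \<Rightarrow> 'a set \<Rightarrow> nat" where
  "hcut E S = card {e \<in> E. e \<inter> S \<noteq> {} \<and> \<not> e \<subseteq> S}"

text \<open>A directed hyperedge \<open>e\<close> is the pair \<open>(L(e), R(e))\<close>.\<close>

definition dihypergraph :: "'a set \<Rightarrow> ('a set \<times> 'a set) set \<Rightarrow> bool" where
  "dihypergraph U A \<longleftrightarrow> finite U \<and> A \<subseteq> Pow U \<times> Pow U"

definition dicut :: "'a set \<Rightarrow> ('a set \<times> 'a set) set \<Rightarrow> 'a set \<Rightarrow> nat" where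
  "dicut U A S = card {(L, R) \<in> A. L \<inter> S \<noteq> {} \<and> R \<inter> (U - S) \<noteq> {}}"

text \<open>
  A cut-sketch consists of stored data \<open>d\<close> (of an arbitrary type) together with a deterministic
  query procedure. The procedure sees only \<open>d\<close> and the queried set \<open>S\<close>; nothing is required of
  its answers on sets that are not contained in \<open>U\<close>.
\<close>

definition cut_sketch ::
  "real \<Rightarrow> 'a set \<Rightarrow> ('a set \<times> 'a set) set \<Rightarrow> ('d \<Rightarrow> 'a set \<Rightarrow> real) \<Rightarrow> 'd \<Rightarrow> bool" where
  "cut_sketch \<epsilon> U A query d \<longleftrightarrow>
     (\<forall>S. S \<subseteq> U \<longrightarrow>
        (1 - \<epsilon>) * real (dicut U A S) \<le> query d S \<and>
        query d S \<le> (1 + \<epsilon>) * real (dicut U A S))"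

end

(* Give each E i its own fresh vertex, the sole tail of all hyperedges coming from E i.  Cutting
   that vertex together with a copy of T \<subseteq> V isolates E i and counts its hyperedges not
   contained in T.  Writing a(T) for this count, the cut of S in E i is a(S) + a(V - S) - a({}), so
   three queries, each with error at most \<epsilon> |E i|, suffice. *)

theory Submission
  imports Defs
begin

text \<open>Inclusion-exclusion on the hyperedges not inside \<open>S\<close> and those not inside
  \<open>V - S\<close>. Failing both containments means being cut, since a hyperedge within
  \<open>V\<close> but not within \<open>V - S\<close> meets \<open>S\<close>. Only the empty
  hyperedge satisfies both, so the correction term counts the nonempty hyperedges rather than all of
  \<open>E\<close>.\<close>

lemma hcut_eq_not_subset_counts:
  assumes "hypergraph V E" "S \<subseteq> V"
  shows "real (hcut E S) = real (card {e \<in> E. \<not> e \<subseteq> S})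
    + real (card {e \<in> E. \<not> e \<subseteq> V - S}) - real (card {e \<in> E. \<not> e \<subseteq> {}})"
proof -
  have E: "finite E" "E \<subseteq> Pow V"
    using assms(1) by (auto simp: hypergraph_def intro: finite_subset)
  let ?X = "{e \<in> E. \<not> e \<subseteq> S}" and ?Y = "{e \<in> E. \<not> e \<subseteq> V - S}"
  have "?X \<union> ?Y = {e \<in> E. \<not> e \<subseteq> {}}" "?X \<inter> ?Y = {e \<in> E. e \<inter> S \<noteq> {} \<and> \<not> e \<subseteq> S}"
    using E assms(2) by blast+
  then have "card ?X + card ?Y = card {e \<in> E. \<not> e \<subseteq> {}} + hcut E S"
    using card_Un_Int[of ?X ?Y] E(1) by (simp add: hcut_def)
  then show ?thesis by linarith
qed

text \<open>The copy of \<open>V\<close> occupies \<open>{1..n}\<close> and the tags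
  \<open>n + i\<close> fill the other half of \<open>{1..2 * n}\<close>. Since the result is a set,
  the tags also keep apart equal hyperedges that come from different \<open>E i\<close>.\<close>

definition tagged_edges ::
  "('a \<Rightarrow> nat) \<Rightarrow> nat \<Rightarrow> (nat \<Rightarrow> 'a set set) \<Rightarrow> (nat set \<times> nat set) set" where
  "tagged_edges f n E = (\<Union>i\<in>{1..n}. (\<lambda>e. ({n + i}, f ` e)) ` E i)"

lemma dihypergraph_tagged_edges:
  assumes "bij_betw f V {1..n}" "\<And>i. i \<in> {1..n} \<Longrightarrow> E i \<subseteq> Pow V"
  shows "dihypergraph {1..2 * n} (tagged_edges f n E)"
proof -
  have "f ` e \<subseteq> {1..2 * n}" if "i \<in> {1..n}" "e \<in> E i" for i e
  proof -
    have "e \<subseteq> V"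
      using assms(2)[OF that(1)] that(2) by blast
    then have "f ` e \<subseteq> f ` V" by (rule image_mono)
    also have "\<dots> = {1..n}"
      using assms(1) by (rule bij_betw_imp_surj_on)
    also have "\<dots> \<subseteq> {1..2 * n}" by auto
    finally show ?thesis .
  qed
  moreover have "{n + i} \<subseteq> {1..2 * n}" if "i \<in> {1..n}" for i
    using that by auto
  ultimately show ?thesis
    unfolding dihypergraph_def tagged_edges_def by blast
qed

text \<open>The query set contains only one tag, so it meets the tails coming from
  \<open>E i\<close> and no others. Heads avoid all tags, so whether a head leaves the query set
  depends on \<open>T\<close> alone.\<close>

lemma dicut_tagged_edges:
  assumes f: "bij_betw f V {1..n}" and E: "\<And>i. i \<in> {1..n} \<Longrightarrow> E i \<subseteq> Pow V"
    and i: "i \<in> {1..n}" and T: "T \<subseteq> V"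
  shows "dicut {1..2 * n} (tagged_edges f n E) (insert (n + i) (f ` T))
    = card {e \<in> E i. \<not> e \<subseteq> T}"
proof -
  let ?U = "{1..2 * n}" and ?Q = "insert (n + i) (f ` T)"
  have inj: "inj_on f V" and im: "f ` V = {1..n}"
    using f by (auto simp: bij_betw_def)
  have rng: "f v \<in> {1..n}" if "v \<in> V" for v
    using im that by blast
  \<comment> \<open>Indices start at 1, so every tag exceeds \<open>n\<close> and lies outside the
    image of \<open>f\<close>.\<close>
  have tag: "n + j \<in> ?Q \<longleftrightarrow> j = i" if "j \<in> {1..n}" for j
  proof -
    have "n + j \<notin> f ` T"
      using that T rng by force
    then show ?thesis by simp
  qed
  have head: "f ` e \<inter> (?U - ?Q) \<noteq> {} \<longleftrightarrow> \<not> e \<subseteq> T" if "e \<subseteq> V" for e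
  proof -
    have "f v \<in> ?U - ?Q \<longleftrightarrow> v \<notin> T" if "v \<in> V" for v
      using rng[OF that] inj_on_image_mem_iff[OF inj that T] i by auto
    then show ?thesis using that by blast
  qed
  have "{(L, R) \<in> tagged_edges f n E. L \<inter> ?Q \<noteq> {} \<and> R \<inter> (?U - ?Q) \<noteq> {}}
      = (\<lambda>e. ({n + i}, f ` e)) ` {e \<in> E i. \<not> e \<subseteq> T}" (is "?lhs = ?rhs")
  proof
    show "?lhs \<subseteq> ?rhs"
    proof clarify
      fix L R
      assume "(L, R) \<in> tagged_edges f n E" and LQ: "L \<inter> ?Q \<noteq> {}" and RQ: "R \<inter> (?U - ?Q) \<noteq> {}"
      then obtain j e where je: "j \<in> {1..n}" "e \<in> E j" "L = {n + j}" "R = f ` e"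
        unfolding tagged_edges_def by blast
      have "n + j \<in> ?Q"
        using LQ by (simp add: je(3) Int_insert_left split: if_splits)
      then have "j = i"
        using tag[OF je(1)] by blast
      moreover have "e \<subseteq> V"
        using E[OF je(1)] je(2) by blast
      then have "\<not> e \<subseteq> T"
        using RQ head je(4) by blast
      ultimately show "(L, R) \<in> ?rhs" using je by blast
    qed
    show "?rhs \<subseteq> ?lhs"
    proof (rule image_subsetI)
      fix e assume "e \<in> {e \<in> E i. \<not> e \<subseteq> T}"
      then have e: "e \<in> E i" "\<not> e \<subseteq> T" by auto
      then have "f ` e \<inter> (?U - ?Q) \<noteq> {}"
        using head[of e] E[OF i] by blast
      moreover have "({n + i}, f ` e) \<in> tagged_edges f n E"
        using e(1) i unfolding tagged_edges_def by blast
      ultimately show "({n + i}, f ` e) \<in> ?lhs" by blast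
    qed
  qed
  \<comment> \<open>If two hyperedges of \<open>E i\<close> had the same tagged copy, the directed
    cut would undercount; injectivity of \<open>f\<close> on \<open>V\<close> excludes this.\<close>
  moreover have "inj_on (\<lambda>e. ({n + i}, f ` e)) {e \<in> E i. \<not> e \<subseteq> T}"
  proof (rule inj_onI)
    fix d e
    assume "d \<in> {e \<in> E i. \<not> e \<subseteq> T}" "e \<in> {e \<in> E i. \<not> e \<subseteq> T}"
    then have "d \<subseteq> V" "e \<subseteq> V"
      using E[OF i] by blast+
    moreover assume "({n + i}, f ` d) = ({n + i}, f ` e)"
    ultimately show "d = e"
      using inj_on_image_eq_iff[OF inj, of d e] by simp
  qed
  ultimately show ?thesis
    by (simp add: dicut_def card_image)
qed

text \<open>\<open>U\<close> and \<open>recover\<close> are chosen before \<open>E\<close>, so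
  information about the hypergraphs reaches the recovery only through \<open>query\<close> and
  \<open>d\<close>. In the other order, \<open>recover\<close> could simply return the exact
  cuts.\<close>

theorem theorem1p4:
  fixes V :: "'v set" and n :: nat
  assumes "finite V" and "card V = n"
  shows "\<exists>(U :: nat set) (recover :: ('d \<Rightarrow> nat set \<Rightarrow> real) \<Rightarrow> 'd \<Rightarrow> nat \<Rightarrow> 'v set \<Rightarrow> real).
           finite U \<and> card U = 2 * n \<and>
           (\<forall>E :: nat \<Rightarrow> 'v set set. (\<forall>i\<in>{1..n}. hypergraph V (E i)) \<longrightarrow>
              (\<exists>A. dihypergraph U A \<and>
                 (\<forall>(\<epsilon>::real) query d. \<epsilon> \<ge> 0 \<longrightarrow> cut_sketch \<epsilon> U A query d \<longrightarrow>
                    (\<forall>i\<in>{1..n}. \<forall>S. S \<subseteq> V \<longrightarrow>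
                       \<bar>recover query d i S - real (hcut (E i) S)\<bar>
                         \<le> 3 * \<epsilon> * real (card (E i))))))"
proof -
  obtain f where f: "bij_betw f V {1..n}"
    using finite_same_card_bij[of V "{1..n}"] assms by auto
  define Q where "Q i T = insert (n + i) (f ` T)" for i T
  \<comment> \<open>Built from \<open>V\<close>, \<open>n\<close> and \<open>f\<close> only, as the
    order of quantifiers demands.\<close>
  define recover :: "('d \<Rightarrow> nat set \<Rightarrow> real) \<Rightarrow> 'd \<Rightarrow> nat \<Rightarrow> 'v set \<Rightarrow> real" where
    "recover query d i S = query d (Q i S) + query d (Q i (V - S)) - query d (Q i {})"
    for query d i S
  have main: "\<bar>recover query d i S - real (hcut (E i) S)\<bar> \<le> 3 * \<epsilon> * real (card (E i))"
    if H: "\<forall>i\<in>{1..n}. hypergraph V (E i)" and \<epsilon>: "\<epsilon> \<ge> 0"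
      and sk: "cut_sketch \<epsilon> {1..2 * n} (tagged_edges f n E) query d"
      and i: "i \<in> {1..n}" and S: "S \<subseteq> V" for E \<epsilon> query d i S
  proof -
    have E: "E j \<subseteq> Pow V" if "j \<in> {1..n}" for j
      using H that by (auto simp: hypergraph_def)
    have fin: "finite (E i)"
      using E[OF i] assms(1) by (auto intro: finite_subset)
    have err: "\<bar>query d (Q i T) - real (card {e \<in> E i. \<not> e \<subseteq> T})\<bar> \<le> \<epsilon> * real (card (E i))"
      if T: "T \<subseteq> V" for T
    proof -
      let ?a = "real (card {e \<in> E i. \<not> e \<subseteq> T})"
      have "f ` T \<subseteq> {1..n}"
        using f T bij_betw_imp_surj_on by blast
      also have "\<dots> \<subseteq> {1..2 * n}" by auto
      finally have "Q i T \<subseteq> {1..2 * n}"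
        using i by (simp add: Q_def)
      moreover have "dicut {1..2 * n} (tagged_edges f n E) (Q i T) = card {e \<in> E i. \<not> e \<subseteq> T}"
        unfolding Q_def using dicut_tagged_edges[OF f E i T] .
      ultimately have "(1 - \<epsilon>) * ?a \<le> query d (Q i T) \<and> query d (Q i T) \<le> (1 + \<epsilon>) * ?a"
        using sk unfolding cut_sketch_def by metis
      then have "\<bar>query d (Q i T) - ?a\<bar> \<le> \<epsilon> * ?a"
        by (simp add: algebra_simps abs_le_iff)
      \<comment> \<open>Here the relative error becomes additive: the queried cut consists of
        hyperedges of \<open>E i\<close> alone, so its size is at most
        \<open>card (E i)\<close>.\<close>
      also have "\<dots> \<le> \<epsilon> * real (card (E i))"
        using \<epsilon> fin by (intro mult_left_mono) (auto intro: card_mono)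
      finally show ?thesis .
    qed
    have "hypergraph V (E i)"
      using H i by blast
    \<comment> \<open>The errors for \<open>S\<close>, \<open>V - S\<close> and \<open>{}\<close>
      add up by the triangle inequality, hence the factor 3.\<close>
    from hcut_eq_not_subset_counts[OF this S] show ?thesis
      using err[OF S] err[OF Diff_subset, of S] err[OF empty_subsetI]
      unfolding recover_def by linarith
  qed
  show ?thesis
  proof (intro exI[of _ "{1..2 * n}"] exI[of _ recover] conjI allI impI)
    fix E :: "nat \<Rightarrow> 'v set set"
    assume H: "\<forall>i\<in>{1..n}. hypergraph V (E i)"
    then have "dihypergraph {1..2 * n} (tagged_edges f n E)"
      by (intro dihypergraph_tagged_edges[OF f]) (auto simp: hypergraph_def)
    with main[OF H] show "\<exists>A. dihypergraph {1..2 * n} A \<and>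
        (\<forall>\<epsilon> query d. \<epsilon> \<ge> 0 \<longrightarrow> cut_sketch \<epsilon> {1..2 * n} A query d \<longrightarrow>
          (\<forall>i\<in>{1..n}. \<forall>S. S \<subseteq> V \<longrightarrow>
            \<bar>recover query d i S - real (hcut (E i) S)\<bar> \<le> 3 * \<epsilon> * real (card (E i))))"
      by blast
  qed auto
qed

end
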